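(* Let $n,r,s,k \in \mathbb{N}$ with $n \geqslant 16kr^2 + 4kr$. Then $$\left(1 - e^{-s^2/4r}\right)n - 2kr\binom{r}{\lceil s/2\rceil} \;\leqslant\; m(n,r,s,k) \;\leqslant\; (s+1)\left\lceil \frac{n}{\lfloor \sqrt{2r}\rfloor} \right\rceil.$$ In particular, if $n = n(r)$ satisfies $n \gg kr\binom{r}{\lceil s/2\rceil}$ as $r \to \infty$, then $$\lim_{r\to\infty} \frac{m(n,r,s,k)}{n} = \begin{cases} 0 & \text{if } s \ll \sqrt{r},\\ 1 & \text{if } s \gg \sqrt{r}.\end{cases}$$
   Context: An $r$-colouring of the complete graph $K_n$ ($n \geqslant 2$) is any function $f: E(K_n) \to [r] = \{1,\dots,r\}$. For a subgraph $H \subseteq K_n$, $c_f(H) = |f(E(H))|$ is the number of distinct colours on edges of $H$. A graph on at least $k+1$ vertices is $k$-connected if deleting any at most $k-1$ vertices leaves a connected graph. $M(f,n,r,s,k)$ is the maximum number of vertices of a $k$-connected subgraph $H \subseteq K_n$ with $c_f(H) \leqslant s$ (taken to be $0$ if no such subgraph exists), and $m(n,r,s,k) = \min_f M(f,n,r,s,k)$, the minimum over all $r$-colourings $f$ of $E(K_n)$. In the limit statement $s$, $k$ and $n$ may depend on $r$; $a \ll b$ means $a/b \to 0$ as $r \to \infty$, and $a \gg b$ means $b \ll a$. *)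

theory Defs
  imports Complex_Main "HOL-Library.FuncSet"
begin

text \<open>A simple graph is given by a vertex set and a set of two-element edges on it.
  The complete graph \<open>K_n\<close> has vertex set \<open>{1..n}\<close>.\<close>

definition complete_edges :: "'a set \<Rightarrow> 'a set set" where
  "complete_edges V = {e. e \<subseteq> V \<and> card e = 2}"

definition subgraph_of_complete :: "nat \<Rightarrow> nat set \<Rightarrow> nat set set \<Rightarrow> bool" where
  "subgraph_of_complete n V E \<longleftrightarrow> V \<subseteq> {1..n} \<and> E \<subseteq> complete_edges V"

definition connected_graph :: "'a set \<Rightarrow> 'a set set \<Rightarrow> bool" where
  "connected_graph V E \<longleftrightarrow> V \<noteq> {} \<and> (\<forall>u\<in>V. \<forall>v\<in>V. (u, v) \<in> {(x, y). {x, y} \<in> E}\<^sup>*)"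

text \<open>Since \<open>card\<close> is \<open>0\<close> on infinite sets, the first conjunct also forces \<open>V\<close> to be finite.
  For \<open>k \<ge> 1\<close>, \<open>card S < k\<close> means at most \<open>k - 1\<close> deleted vertices.\<close>

definition k_connected :: "nat \<Rightarrow> 'a set \<Rightarrow> 'a set set \<Rightarrow> bool" where
  "k_connected k V E \<longleftrightarrow> k + 1 \<le> card V \<and>
     (\<forall>S. S \<subseteq> V \<and> card S < k \<longrightarrow> connected_graph (V - S) {e \<in> E. e \<inter> S = {}})"

definition colourings :: "nat \<Rightarrow> nat \<Rightarrow> (nat set \<Rightarrow> nat) set" where
  "colourings n r = complete_edges {1..n} \<rightarrow>\<^sub>E {1..r}"

definition num_colours :: "(nat set \<Rightarrow> nat) \<Rightarrow> nat set set \<Rightarrow> nat" where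
  "num_colours f E = card (f ` E)"

text \<open>Inserting \<open>0\<close> gives the value \<open>0\<close> when there is no such subgraph, and changes nothing
  otherwise. The number of colours \<open>r\<close> is not an argument, as the right-hand side depends on it
  only through \<open>f\<close>.\<close>

definition max_order :: "(nat set \<Rightarrow> nat) \<Rightarrow> nat \<Rightarrow> nat \<Rightarrow> nat \<Rightarrow> nat" where
  "max_order f n s k = Max (insert 0
     {card V | V E. subgraph_of_complete n V E \<and> k_connected k V E \<and> num_colours f E \<le> s})"

definition min_max_order :: "nat \<Rightarrow> nat \<Rightarrow> nat \<Rightarrow> nat \<Rightarrow> nat" where
  "min_max_order n r s k = Min ((\<lambda>f. max_order f n s k) ` colourings n r)"

definition much_less :: "(nat \<Rightarrow> real) \<Rightarrow> (nat \<Rightarrow> real) \<Rightarrow> bool" (infix "\<lless>" 50) where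
  "a \<lless> b \<longleftrightarrow> (\<lambda>r. a r / b r) \<longlonglongrightarrow> 0"

end

theory Submission
  imports Defs
begin

text \<open>Upper bound: split the vertices into \<open>\<lfloor>\<surd>(2r)\<rfloor>\<close> blocks of nearly equal size and give each pair of
  blocks its own colour. A connected subgraph with at most \<open>s\<close> colours induces a connected graph
  with at most \<open>s\<close> edges on the blocks that it meets, so it meets at most \<open>s + 1\<close> of them.

  Lower bound: the case \<open>r \<le> s\<close> is trivial, and for \<open>s = 1\<close> Mader's theorem applied to a majority
  colour suffices. Otherwise let \<open>H\<close> be a largest \<open>k\<close>-connected subgraph with at most \<open>\<lfloor>s/2\<rfloor>\<close> colours; again
  by Mader's theorem, it has at least \<open>8kr + 2k\<close> vertices. Put \<open>c = \<lceil>s/2\<rceil>\<close>. If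
  more than \<open>2kr\<close> vertices outside \<open>H\<close> sent, up to \<open>kr\<close> exceptions each, only edges with colours
  from one set of \<open>c - 1\<close> colours to \<open>H\<close>, then these edges would form a larger \<open>k\<close>-connected
  subgraph. Hence all but \<open>2kr (r choose c)\<close> of the outside vertices send at least \<open>k\<close> edges to
  \<open>H\<close> in each of at least \<open>c\<close> colours. Some \<open>c\<close> colours, chosen greedily, hit all but a fraction
  \<open>(1 - c/r)\<^sup>c \<le> exp (- s\<^sup>2/4r)\<close> of the latter, and the vertices that are hit can be joined
  to \<open>H\<close>.\<close>

section \<open>Complete graphs, and connectivity in terms of cuts\<close>

lemma complete_edges_mono: "U \<subseteq> V \<Longrightarrow> complete_edges U \<subseteq> complete_edges V"
  by (auto simp: complete_edges_def)

lemma doubleton_in_complete_edges [simp]: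
  "{x, y} \<in> complete_edges V \<longleftrightarrow> x \<in> V \<and> y \<in> V \<and> x \<noteq> y"
  by (auto simp: complete_edges_def card_insert_if)

lemma complete_edgesE:
  assumes "e \<in> complete_edges V"
  obtains x y where "e = {x, y}" "x \<in> V" "y \<in> V" "x \<noteq> y"
  using assms by (auto simp: complete_edges_def card_2_iff)

lemma finite_complete_edges [simp]: "finite V \<Longrightarrow> finite (complete_edges V)"
  by (simp add: complete_edges_def)

lemma card_complete_edges: "finite V \<Longrightarrow> card (complete_edges V) = card V choose 2"
  unfolding complete_edges_def by (rule n_subsets)

lemma real_choose_two: "real (n choose 2) = real n * (real n - 1) / 2"
  by (cases n) (auto simp: choose_two real_of_nat_div field_simps)

text \<open>A walk from inside \<open>X\<close> to outside must leave \<open>X\<close> along some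
  edge; \<open>E \<subseteq> complete_edges V\<close> keeps the walk inside
  \<open>V\<close>.\<close>

lemma connected_graph_cutD:
  assumes "connected_graph V E" "E \<subseteq> complete_edges V" "X \<subseteq> V" "X \<noteq> {}" "X \<noteq> V"
  shows "\<exists>x\<in>X. \<exists>y\<in>V - X. {x, y} \<in> E"
proof (rule ccontr)
  assume no: "\<not> ?thesis"
  obtain u v where uv: "u \<in> X" "v \<in> V" "v \<notin> X" using assms by auto
  have "(u, v) \<in> {(x, y). {x, y} \<in> E}\<^sup>*"
    using assms(1,3) uv unfolding connected_graph_def by blast
  then have "v \<in> X"
  proof (induction rule: rtrancl_induct)
    case (step y z)
    then have "{y, z} \<in> complete_edges V" using assms(2) by blast
    then have "z \<in> V" by (simp only: doubleton_in_complete_edges)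
    with step no show ?case by blast
  qed (use uv in simp)
  with uv show False by simp
qed

text \<open>If the vertices reachable from \<open>u\<close> were not all of \<open>V\<close>, then
  \<open>cut\<close> would give an edge leaving them, whose far end is reachable too.\<close>

lemma connected_graph_cutI:
  assumes "V \<noteq> {}"
    and cut: "\<And>X. X \<subseteq> V \<Longrightarrow> X \<noteq> {} \<Longrightarrow> X \<noteq> V \<Longrightarrow> \<exists>x\<in>X. \<exists>y\<in>V - X. {x, y} \<in> E"
  shows "connected_graph V E"
  unfolding connected_graph_def
proof (intro conjI ballI)
  fix u v assume uv: "u \<in> V" "v \<in> V"
  let ?R = "{(x, y). {x, y} \<in> E}\<^sup>*"
  have "{z \<in> V. (u, z) \<in> ?R} = V"
  proof (rule ccontr)
    assume "{z \<in> V. (u, z) \<in> ?R} \<noteq> V"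
    with cut[of "{z \<in> V. (u, z) \<in> ?R}"] uv
    obtain x y where "(u, x) \<in> ?R" "y \<in> V" "(u, y) \<notin> ?R" "{x, y} \<in> E" by auto
    then show False by (auto dest: rtrancl_into_rtrancl)
  qed
  with uv show "(u, v) \<in> ?R" by auto
qed (fact assms(1))

section \<open>k-connected graphs: cuts, extension and Mader's theorem\<close>

text \<open>\<open>E\<close> is restricted to \<open>V\<close> only in the conclusion, so that a
  union of colour classes \<open>{e. f e \<in> C}\<close> can be taken for \<open>E\<close> as it
  stands.\<close>

lemma k_connected_cutI:
  assumes "k + 1 \<le> card V"
    and cut: "\<And>S X. S \<subseteq> V \<Longrightarrow> card S < k \<Longrightarrow> X \<subseteq> V - S \<Longrightarrow> X \<noteq> {} \<Longrightarrow> X \<noteq> V - S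
      \<Longrightarrow> \<exists>x\<in>X. \<exists>y\<in>V - S - X. {x, y} \<in> E"
  shows "k_connected k V (E \<inter> complete_edges V)"
  unfolding k_connected_def
proof (intro conjI allI impI)
  fix S assume S: "S \<subseteq> V \<and> card S < k"
  show "connected_graph (V - S) {e \<in> E \<inter> complete_edges V. e \<inter> S = {}}"
  proof (rule connected_graph_cutI)
    show "V - S \<noteq> {}"
    proof
      assume "V - S = {}"
      with S have "V = S" by auto
      with S assms(1) show False by simp
    qed
  next
    fix X assume X: "X \<subseteq> V - S" "X \<noteq> {}" "X \<noteq> V - S"
    with cut S obtain x y where "x \<in> X" "y \<in> V - S - X" "{x, y} \<in> E" by meson
    then show "\<exists>x\<in>X. \<exists>y\<in>V - S - X. {x, y} \<in> {e \<in> E \<inter> complete_edges V. e \<inter> S = {}}"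
      using X(1) by (intro bexI[of _ x] bexI[of _ y]) auto
  qed
qed (fact assms(1))

lemma k_connected_cutD:
  assumes "k_connected k V E" "E \<subseteq> complete_edges V" "S \<subseteq> V" "card S < k"
    and "X \<subseteq> V - S" "X \<noteq> {}" "X \<noteq> V - S"
  shows "\<exists>x\<in>X. \<exists>y\<in>V - S - X. {x, y} \<in> E"
proof -
  have "connected_graph (V - S) {e \<in> E. e \<inter> S = {}}"
    using assms unfolding k_connected_def by blast
  moreover have "{e \<in> E. e \<inter> S = {}} \<subseteq> complete_edges (V - S)"
    using assms(2) by (auto simp: complete_edges_def)
  ultimately show ?thesis using connected_graph_cutD assms(5-7) by blast
qed

lemma k_connected_finite: "k_connected k V E \<Longrightarrow> finite V"
  unfolding k_connected_def by (metis add_is_0 card.infinite le_zero_eq one_neq_zero)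

lemma k_connected_complete:
  assumes "k + 1 \<le> card V"
  shows "k_connected k V (complete_edges V)"
  using k_connected_cutI[OF assms, of UNIV] by auto

text \<open>Fewer than \<open>k\<close> deletions leave every vertex of \<open>U\<close> a neighbour
  in \<open>V\<close>, so it stays attached to the rest of \<open>V\<close>, which is still
  connected.\<close>

lemma k_connected_extend:
  assumes con: "k_connected k V E" and E: "E \<subseteq> complete_edges V" "E \<subseteq> E'"
    and U: "finite U" and deg: "\<And>u. u \<in> U \<Longrightarrow> k \<le> card {x \<in> V. {u, x} \<in> E'}"
  shows "k_connected k (V \<union> U) (E' \<inter> complete_edges (V \<union> U))"
proof (rule k_connected_cutI)
  have fin: "finite V" using con by (rule k_connected_finite)
  have "k + 1 \<le> card V" using con by (simp add: k_connected_def)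
  also have "card V \<le> card (V \<union> U)" using U fin by (intro card_mono) auto
  finally show "k + 1 \<le> card (V \<union> U)" .
  fix S X assume S: "S \<subseteq> V \<union> U" "card S < k"
    and X: "X \<subseteq> V \<union> U - S" "X \<noteq> {}" "X \<noteq> V \<union> U - S"
  have finS: "finite S" using S U fin by (meson finite_UnI finite_subset)
  have nb: "\<exists>x\<in>V - S. {u, x} \<in> E'" if "u \<in> U" for u
  proof (rule ccontr)
    assume "\<not> ?thesis"
    then have "{x \<in> V. {u, x} \<in> E'} \<subseteq> S" by auto
    then have "card {x \<in> V. {u, x} \<in> E'} \<le> card S" using finS by (rule card_mono[rotated])
    with deg[OF that] S show False by simp
  qed
  \<comment> \<open>\<open>X\<close> misses \<open>V\<close>, contains all that is left of
    \<open>V\<close>, or splits it. In the first two cases a vertex of \<open>U\<close> and its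
    neighbour in \<open>V\<close> cross the cut; in the third, \<open>con\<close> gives the
    edge.\<close>
  consider "X \<inter> V = {}" | "V - S \<subseteq> X" | "X \<inter> V \<noteq> {}" "X \<inter> V \<noteq> V - S \<inter> V" by auto
  then show "\<exists>x\<in>X. \<exists>y\<in>V \<union> U - S - X. {x, y} \<in> E'"
  proof cases
    case 1
    then obtain u where u: "u \<in> X" "u \<in> U" using X by auto
    from nb[OF u(2)] obtain x where "x \<in> V - S" "{u, x} \<in> E'" by auto
    with u 1 show ?thesis by blast
  next
    case 2
    then obtain u where u: "u \<in> V \<union> U - S - X" "u \<in> U" using X by auto
    from nb[OF u(2)] obtain x where "x \<in> V - S" "{x, u} \<in> E'" by (auto simp: insert_commute)
    with u 2 show ?thesis by blast
  next
    case 3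
    have "card (S \<inter> V) \<le> card S" using finS by (intro card_mono) auto
    with S have "card (S \<inter> V) < k" by simp
    from k_connected_cutD[OF con E(1) _ this, of "X \<inter> V"] 3 X
    obtain x y where "x \<in> X" "y \<in> V - S - X" "{x, y} \<in> E" by blast
    with E(2) show ?thesis by blast
  qed
qed

text \<open>Mader's theorem. The bound \<open>\<gamma> * (card V - k)\<close> is inherited after deleting a vertex of
  degree at most \<open>\<gamma>\<close>, and by one of the two sides of a separation of order less than \<open>k\<close>.\<close>

lemma mader_k_connected_subgraph:
  fixes \<gamma> :: real
  assumes "finite V" "1 \<le> k" "2 * real k \<le> \<gamma>" "2 * k \<le> card V"
    and "\<gamma> * (real (card V) - real k) < real (card (E \<inter> complete_edges V))"
  shows "\<exists>U\<subseteq>V. \<gamma> < real (card U) \<and> k_connected k U (E \<inter> complete_edges U)"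
  using assms(1,4,5)
proof (induction "card V" arbitrary: V rule: less_induct)
  case less
  let ?G = "E \<inter> complete_edges V"
  have finG: "finite ?G" using less.prems by simp
  show ?case
  proof (cases "\<exists>v\<in>V. real (card {e \<in> ?G. v \<in> e}) \<le> \<gamma>")
    case True
    then obtain v where v: "v \<in> V" "real (card {e \<in> ?G. v \<in> e}) \<le> \<gamma>" by auto
    \<comment> \<open>At exactly \<open>2 * k\<close> vertices the hypothesis would ask for more
      than \<open>\<gamma> * k\<close>, hence more than 2k^2, edges, but there is room for only
      \<open>k * (2 * k - 1)\<close>. So one vertex can be deleted without falling below
      \<open>2 * k\<close>.\<close>
    have "card V \<noteq> 2 * k"
    proof
      assume eq: "card V = 2 * k"
      have "real (card ?G) \<le> real (card (complete_edges V))"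
        using less.prems by (intro of_nat_mono card_mono) auto
      also have "\<dots> = real k * (2 * real k - 1)"
        using less.prems eq by (simp add: card_complete_edges real_choose_two)
      also have "\<dots> \<le> real k * \<gamma>" using assms by (intro mult_left_mono) auto
      finally show False using less.prems(3) eq by (simp add: algebra_simps)
    qed
    then have big: "2 * k \<le> card (V - {v})" using less.prems v by simp
    have cardV: "real (card (V - {v})) = real (card V) - 1"
      using card_Suc_Diff1[OF less.prems(1) v(1)] by linarith
    have "?G - {e \<in> ?G. v \<in> e} = E \<inter> complete_edges (V - {v})"
      by (auto simp: complete_edges_def)
    then have "real (card (E \<inter> complete_edges (V - {v}))) = real (card ?G) - real (card {e \<in> ?G. v \<in> e})"
      using finG by (metis (no_types, lifting) card_Diff_subset card_mono finite_subset mem_Collect_eq of_nat_diff subsetI)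
    then have "\<gamma> * (real (card (V - {v})) - real k) < real (card (E \<inter> complete_edges (V - {v})))"
      using less.prems(3) v(2) unfolding cardV by (simp add: algebra_simps)
    moreover have "card (V - {v}) < card V" using less.prems(1) v(1) by (rule card_Diff1_less)
    ultimately show ?thesis using less.hyps[of "V - {v}"] less.prems big by blast
  next
    case False
    \<comment> \<open>All degrees now exceed \<open>\<gamma>\<close>, so a set containing all
      neighbours of one vertex has more than \<open>\<gamma>\<close> elements. This serves for
      \<open>V\<close> and for both sides of a separation, which thus stay above
      \<open>2 * k\<close>.\<close>
    have deg: "\<gamma> < real (card U)"
      if "finite U" "v \<in> V" "\<And>x. {v, x} \<in> ?G \<Longrightarrow> x \<in> U" for v U
    proof -
      have "{e \<in> ?G. v \<in> e} \<subseteq> (\<lambda>x. {v, x}) ` U"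
      proof
        fix e assume e: "e \<in> {e \<in> ?G. v \<in> e}"
        then obtain x where "e = {v, x}" by (auto elim!: complete_edgesE)
        with e that(3) show "e \<in> (\<lambda>x. {v, x}) ` U" by auto
      qed
      then have "card {e \<in> ?G. v \<in> e} \<le> card U" using that(1) by (meson surj_card_le)
      with False that(2) show ?thesis by force
    qed
    have "V \<noteq> {}" using less.prems assms by auto
    then have cV: "\<gamma> < real (card V)" using deg[of V] less.prems by fastforce
    show ?thesis
    proof (cases "k_connected k V ?G")
      case True
      with cV show ?thesis by blast
    next
      case False
      have "k + 1 \<le> card V" using cV assms by linarith
      with False obtain S X where S: "S \<subseteq> V" "card S < k"
        and X: "X \<subseteq> V - S" "X \<noteq> {}" "X \<noteq> V - S"
        and sep: "\<And>x y. x \<in> X \<Longrightarrow> y \<in> V - S - X \<Longrightarrow> {x, y} \<notin> E"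
        using k_connected_cutI[of k V E] by blast
      define U1 U2 where "U1 = X \<union> S" and "U2 = V - X"
      have fin: "finite U1" "finite U2" "finite X" "finite S"
        using less.prems S X unfolding U1_def U2_def by (auto intro: finite_subset)
      have sub: "U1 \<subset> V" "U2 \<subset> V" using S X unfolding U1_def U2_def by auto
      have c1: "card U1 = card X + card S"
        unfolding U1_def using fin X by (intro card_Un_disjoint) auto
      have c2: "card U2 + card X = card V"
        unfolding U2_def using less.prems fin X
        by (metis Diff_subset card_Diff_subset card_mono le_add_diff_inverse2 order_trans)
      obtain x y where xy: "x \<in> X" "y \<in> V - S - X" using X by auto
      have g1: "\<gamma> < real (card U1)"
      proof (rule deg[of _ x])
        fix z assume z: "{x, z} \<in> ?G"
        then have "z \<in> V" by auto
        with z sep xy show "z \<in> U1" unfolding U1_def by blast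
      qed (use fin X xy in auto)
      have g2: "\<gamma> < real (card U2)"
      proof (rule deg[of _ y])
        fix z assume z: "{y, z} \<in> ?G"
        then have "z \<in> V" "{z, y} \<in> ?G" by (auto simp: insert_commute)
        with sep xy show "z \<in> U2" unfolding U2_def by blast
      qed (use fin X xy in auto)
      have "?G \<subseteq> (E \<inter> complete_edges U1) \<union> (E \<inter> complete_edges U2)"
      proof
        fix e assume e: "e \<in> ?G"
        then obtain a b where ab: "e = {a, b}" "a \<in> V" "b \<in> V" "a \<noteq> b"
          by (auto elim!: complete_edgesE)
        have "{b, a} \<in> ?G" using e ab by (simp add: insert_commute)
        with sep[of a b] sep[of b a] e ab
        show "e \<in> (E \<inter> complete_edges U1) \<union> (E \<inter> complete_edges U2)"
          unfolding U1_def U2_def by auto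
      qed
      then have "card ?G \<le> card (E \<inter> complete_edges U1) + card (E \<inter> complete_edges U2)"
        using fin by (meson card_Un_le card_mono finite_Int finite_UnI finite_complete_edges order_trans)
      moreover have "\<gamma> * (real (card U1) - real k) + \<gamma> * (real (card U2) - real k)
          \<le> \<gamma> * (real (card V) - real k)"
      proof -
        \<comment> \<open>The two sides overlap in \<open>S\<close>, which has fewer than
          \<open>k\<close> vertices. Subtracting \<open>k\<close> in the edge bound pays for this
          overlap: the bounds for the sides add up to at most the bound for \<open>V\<close>, so one
          side inherits it.\<close>
        have "real (card U1) + real (card U2) \<le> real (card V) + real k" using c1 c2 S by simp
        then have "\<gamma> * ((real (card U1) - real k) + (real (card U2) - real k)) \<le> \<gamma> * (real (card V) - real k)"
          using assms by (intro mult_left_mono) auto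
        then show ?thesis by (simp add: algebra_simps)
      qed
      ultimately have "\<gamma> * (real (card U1) - real k) < real (card (E \<inter> complete_edges U1)) \<or>
          \<gamma> * (real (card U2) - real k) < real (card (E \<inter> complete_edges U2))"
        using less.prems(3) by linarith
      then obtain U where U: "U \<subset> V" "finite U" "\<gamma> < real (card U)"
          "\<gamma> * (real (card U) - real k) < real (card (E \<inter> complete_edges U))"
        using sub fin g1 g2 by blast
      have "card U < card V" using U less.prems by (simp add: psubset_card_mono)
      moreover have "2 * k \<le> card U" using U assms by linarith
      ultimately show ?thesis using less.hyps[of U] U by blast
    qed
  qed
qed

section \<open>Dense bipartite graphs and greedy covering\<close>

text \<open>Dropping the few vertices of \<open>A\<close> with fewer than \<open>k\<close>
  neighbours in \<open>W\<close> leaves a graph in which any two vertices of \<open>W\<close> keep a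
  common neighbour after fewer than \<open>k\<close> deletions. At most \<open>2 * d\<close>
  vertices are lost and more than \<open>2 * d\<close> are gained, so the result is larger than
  \<open>A\<close>.\<close>

lemma bipartite_k_connected:
  assumes fin: "finite A" "finite W" and dis: "A \<inter> W = {}"
    and N: "\<And>w. w \<in> W \<Longrightarrow> card {a \<in> A. {w, a} \<notin> E} \<le> d"
    and k: "1 \<le> k" "k \<le> d" and W: "2 * d < card W" and A: "4 * d + k \<le> card A"
  shows "\<exists>A'\<subseteq>A. card A \<le> card A' + 2 * d \<and> k_connected k (A' \<union> W) (E \<inter> complete_edges (A' \<union> W))"
proof -
  define B where "B = {a \<in> A. card {w \<in> W. {w, a} \<in> E} < k}"
  have BA: "B \<subseteq> A" and finB: "finite B" using fin unfolding B_def by auto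
  \<comment> \<open>Non-edges between \<open>B\<close> and \<open>W\<close> are counted twice: each
    vertex of \<open>B\<close> lies on at least \<open>card W - k + 1\<close> of them, which is more
    than half of \<open>card W\<close> because \<open>k \<le> d\<close> and
    \<open>2 * d < card W\<close>, while each vertex of \<open>W\<close> lies on at most
    \<open>d\<close>.\<close>
  have "card B \<le> 2 * d"
  proof -
    have "card B * (card W - k + 1) \<le> (\<Sum>a\<in>B. card {w \<in> W. {w, a} \<notin> E})"
    proof -
      have "card W - k + 1 \<le> card {w \<in> W. {w, a} \<notin> E}" if "a \<in> B" for a
      proof -
        have "{w \<in> W. {w, a} \<notin> E} = W - {w \<in> W. {w, a} \<in> E}" by auto
        then have "card {w \<in> W. {w, a} \<notin> E} = card W - card {w \<in> W. {w, a} \<in> E}"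
          using fin by (simp add: card_Diff_subset)
        moreover have "card {w \<in> W. {w, a} \<in> E} \<le> card W" using fin by (intro card_mono) auto
        ultimately show ?thesis using that k W unfolding B_def by auto
      qed
      from sum_mono[of B "\<lambda>_. card W - k + 1", OF this] show ?thesis by simp
    qed
    also have "\<dots> = (\<Sum>a\<in>B. \<Sum>w\<in>W. of_bool ({w, a} \<notin> E))"
      using fin by (simp add: sum.If_cases of_bool_def Int_def)
    also have "\<dots> = (\<Sum>w\<in>W. \<Sum>a\<in>B. of_bool ({w, a} \<notin> E))" by (rule sum.swap)
    also have "\<dots> = (\<Sum>w\<in>W. card {a \<in> B. {w, a} \<notin> E})"
      using finB by (simp add: sum.If_cases of_bool_def Int_def)
    also have "\<dots> \<le> (\<Sum>w\<in>W. d)"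
    proof (rule sum_mono)
      fix w assume "w \<in> W"
      have "card {a \<in> B. {w, a} \<notin> E} \<le> card {a \<in> A. {w, a} \<notin> E}"
        using fin BA by (intro card_mono) auto
      with N[OF \<open>w \<in> W\<close>] show "card {a \<in> B. {w, a} \<notin> E} \<le> d" by linarith
    qed
    finally have le: "card B * (card W - k + 1) \<le> card W * d" by simp
    show ?thesis
    proof (rule ccontr)
      assume "\<not> ?thesis"
      then have "2 * d \<le> card B" by simp
      then have "2 * d * (card W - k + 1) \<le> card W * d"
        using le by (meson le_trans mult_le_mono1)
      then have "d * (2 * (card W - k + 1)) \<le> d * card W" by (simp add: ac_simps)
      then have "2 * (card W - k + 1) \<le> card W"
        using k by (metis less_le_trans nat_mult_le_cancel1 zero_less_one)
      with W k show False by arith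
    qed
  qed
  define A' where "A' = A - B"
  have finA': "finite A'" and A'A: "A' \<subseteq> A" using fin unfolding A'_def by auto
  have cA: "card A' + card B = card A"
    unfolding A'_def using fin BA finB by (simp add: card_Diff_subset card_mono)
  have cV: "card (A' \<union> W) = card A' + card W"
    using finA' fin dis A'A by (intro card_Un_disjoint) auto
  have "k_connected k (A' \<union> W) (E \<inter> complete_edges (A' \<union> W))"
  proof (rule k_connected_cutI)
    show "k + 1 \<le> card (A' \<union> W)" using cV W k by linarith
    fix S X assume S: "S \<subseteq> A' \<union> W" "card S < k"
      and X: "X \<subseteq> A' \<union> W - S" "X \<noteq> {}" "X \<noteq> A' \<union> W - S"
    have finS: "finite S" using S finA' fin by (meson finite_UnI finite_subset)
    let ?Y = "A' \<union> W - S - X"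
    have nbA: "\<exists>w\<in>W - S. {w, a} \<in> E \<and> {a, w} \<in> E" if "a \<in> A'" for a
    proof (rule ccontr)
      assume "\<not> ?thesis"
      then have "{w \<in> W. {w, a} \<in> E} \<subseteq> S" by (auto simp: insert_commute)
      then have "card {w \<in> W. {w, a} \<in> E} \<le> card S" using finS by (rule card_mono[rotated])
      with that S show False unfolding A'_def B_def by auto
    qed
    \<comment> \<open>\<open>A'\<close> keeps at least \<open>2 * d + k\<close> vertices. Fewer than
      \<open>k\<close> of them are deleted, and each of \<open>v\<close> and \<open>w\<close> has at
      most \<open>d\<close> non-neighbours.\<close>
    have common: "\<exists>a\<in>A' - S. {v, a} \<in> E \<and> {a, w} \<in> E" if "v \<in> W" "w \<in> W" for v w
    proof (rule ccontr)
      assume "\<not> ?thesis"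
      then have "A' \<subseteq> S \<union> {a \<in> A. {v, a} \<notin> E} \<union> {a \<in> A. {w, a} \<notin> E}"
        using A'A by (auto simp: insert_commute)
      then have "card A' \<le> card (S \<union> {a \<in> A. {v, a} \<notin> E} \<union> {a \<in> A. {w, a} \<notin> E})"
        using finS fin by (intro card_mono) auto
      also have "\<dots> \<le> card S + card {a \<in> A. {v, a} \<notin> E} + card {a \<in> A. {w, a} \<notin> E}"
        by (meson add_le_mono1 card_Un_le order_trans)
      finally show False using N[OF that(1)] N[OF that(2)] S cA A \<open>card B \<le> 2 * d\<close> by linarith
    qed
    show "\<exists>x\<in>X. \<exists>y\<in>?Y. {x, y} \<in> E"
    proof (rule ccontr)
      assume no: "\<not> ?thesis"
      have no': "{x, y} \<notin> E \<and> {y, x} \<notin> E" if "x \<in> X" "y \<in> ?Y" for x y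
        using no that by (metis insert_commute)
      \<comment> \<open>Both sides of the cut meet \<open>W\<close>, since a vertex of
        \<open>A'\<close> has a neighbour in \<open>W - S\<close>, which lies on its own side if no
        edge crosses. A common neighbour of vertices of \<open>W\<close> on opposite sides then does
        have a crossing edge.\<close>
      obtain x y where xy: "x \<in> X" "y \<in> ?Y" using X by auto
      have "\<exists>v\<in>W. v \<in> X"
      proof (cases "x \<in> W")
        case False
        then have "x \<in> A'" using xy X by auto
        from nbA[OF this] no' xy show ?thesis by blast
      qed (use xy in auto)
      moreover have "\<exists>w\<in>W. w \<in> ?Y"
      proof (cases "y \<in> W")
        case False
        then have "y \<in> A'" using xy X by auto
        from nbA[OF this] no' xy show ?thesis by blast
      qed (use xy in auto)
      ultimately obtain v w where vw: "v \<in> W" "v \<in> X" "w \<in> W" "w \<in> ?Y" by blast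
      from common[OF vw(1,3)] no' vw show False by blast
    qed
  qed
  then show ?thesis using A'A cA \<open>card B \<le> 2 * d\<close> by (intro exI[of _ A']) auto
qed

text \<open>By averaging, some element of \<open>R\<close> lies in \<open>F u\<close> for at least a
  fraction \<open>c / card R\<close> of the \<open>u\<close> not yet hit; adding it to
  \<open>C\<close> shrinks their number by the factor \<open>1 - c / card R\<close>. This factor is
  nonnegative by \<open>c \<le> card R\<close>, so the bounds multiply along the induction.\<close>

lemma greedy_cover:
  fixes F :: "'a \<Rightarrow> 'b set"
  assumes "finite U" "finite R" "R \<noteq> {}"
    and F: "\<And>u. u \<in> U \<Longrightarrow> F u \<subseteq> R" "\<And>u. u \<in> U \<Longrightarrow> c \<le> card (F u)"
    and "c \<le> card R"
  shows "\<exists>C\<subseteq>R. card C \<le> j \<and>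
    real (card {u \<in> U. F u \<inter> C = {}}) \<le> (1 - real c / real (card R)) ^ j * real (card U)"
proof (induction j)
  case 0
  show ?case by (intro exI[of _ "{}"]) auto
next
  case (Suc j)
  then obtain C where C: "C \<subseteq> R" "card C \<le> j"
    "real (card {u \<in> U. F u \<inter> C = {}}) \<le> (1 - real c / real (card R)) ^ j * real (card U)" by auto
  let ?L = "{u \<in> U. F u \<inter> C = {}}" and ?r = "real (card R)"
  have r: "?r > 0" using assms by (simp add: card_gt_0_iff)
  have "\<exists>i\<in>R. real c / ?r * real (card ?L) \<le> real (card {u \<in> ?L. i \<in> F u})"
  proof (rule ccontr)
    assume "\<not> ?thesis"
    then have "(\<Sum>i\<in>R. real (card {u \<in> ?L. i \<in> F u})) < (\<Sum>i\<in>R. real c / ?r * real (card ?L))"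
      using assms by (intro sum_strict_mono) auto
    also have "\<dots> = real c * real (card ?L)" using r by simp
    also have "\<dots> \<le> (\<Sum>u\<in>?L. real (card (F u)))"
      using sum_mono[of ?L "\<lambda>_. real c" "\<lambda>u. real (card (F u))"] F by (simp add: mult.commute)
    also have "\<dots> = (\<Sum>u\<in>?L. \<Sum>i\<in>R. of_bool (i \<in> F u))"
    proof (rule sum.cong[OF refl])
      fix u assume "u \<in> ?L"
      then have "R \<inter> {i. i \<in> F u} = F u" using F by auto
      then show "real (card (F u)) = (\<Sum>i\<in>R. of_bool (i \<in> F u))"
        using assms(2) by (simp add: sum.If_cases of_bool_def)
    qed
    also have "\<dots> = (\<Sum>i\<in>R. \<Sum>u\<in>?L. of_bool (i \<in> F u))" by (rule sum.swap)
    also have "\<dots> = (\<Sum>i\<in>R. real (card {u \<in> ?L. i \<in> F u}))"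
      using assms(1) by (simp add: sum.If_cases of_bool_def Int_def)
    finally show False by simp
  qed
  then obtain i where i: "i \<in> R" "real c / ?r * real (card ?L) \<le> real (card {u \<in> ?L. i \<in> F u})"
    by auto
  have "{u \<in> U. F u \<inter> insert i C = {}} = ?L - {u \<in> ?L. i \<in> F u}" by auto
  moreover have "card {u \<in> ?L. i \<in> F u} \<le> card ?L" using assms by (intro card_mono) auto
  moreover have "card (?L - {u \<in> ?L. i \<in> F u}) = card ?L - card {u \<in> ?L. i \<in> F u}"
    using assms(1) by (intro card_Diff_subset) auto
  ultimately have "real (card {u \<in> U. F u \<inter> insert i C = {}}) = real (card ?L) - real (card {u \<in> ?L. i \<in> F u})"
    by (simp only: of_nat_diff)
  also have "\<dots> \<le> (1 - real c / ?r) * real (card ?L)" using i by (simp add: algebra_simps)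
  also have "\<dots> \<le> (1 - real c / ?r) * ((1 - real c / ?r) ^ j * real (card U))"
    using C(3) r assms(6) by (intro mult_left_mono) (auto simp: field_simps)
  finally have "real (card {u \<in> U. F u \<inter> insert i C = {}}) \<le> (1 - real c / ?r) ^ Suc j * real (card U)"
    by (simp add: mult.assoc)
  moreover have "card (insert i C) \<le> Suc j"
    using C by (metis Suc_le_mono card_insert_le_m1 card_insert_if finite_subset assms(2) le_SucI)
  ultimately show ?case using i C by (intro exI[of _ "insert i C"]) auto
qed

section \<open>The maximum order and its minimum over all colourings\<close>

text \<open>All orders are at most \<open>n\<close>, so the \<open>Max\<close> in
  \<open>max_order\<close> is a genuine maximum.\<close>

lemma finite_orders:
  "finite {card V | V E. subgraph_of_complete n V E \<and> k_connected k V E \<and> num_colours f E \<le> s}"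
proof (rule finite_subset)
  show "{card V | V E. subgraph_of_complete n V E \<and> k_connected k V E \<and> num_colours f E \<le> s} \<subseteq> {..n}"
    using card_mono[of "{1..n}"] by (fastforce simp: subgraph_of_complete_def)
qed simp

text \<open>A palette \<open>C\<close> stands for a subgraph: all edges on \<open>V\<close> with a
  colour in \<open>C\<close> are taken, which uses at most \<open>card C\<close> colours.\<close>

lemma max_order_ge:
  assumes "V \<subseteq> {1..n}" "k_connected k V ({e. f e \<in> C} \<inter> complete_edges V)"
    and "finite C" "card C \<le> s"
  shows "card V \<le> max_order f n s k"
proof -
  have "num_colours f ({e. f e \<in> C} \<inter> complete_edges V) \<le> card C"
    unfolding num_colours_def using assms(3) by (intro card_mono) auto
  then have "num_colours f ({e. f e \<in> C} \<inter> complete_edges V) \<le> s" using assms(4) by simp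
  moreover have "subgraph_of_complete n V ({e. f e \<in> C} \<inter> complete_edges V)"
    using assms(1) unfolding subgraph_of_complete_def by simp
  ultimately have "card V \<in> {card V | V E. subgraph_of_complete n V E \<and> k_connected k V E \<and> num_colours f E \<le> s}"
    using assms(2) by (intro CollectI exI conjI) (rule refl)
  then show ?thesis unfolding max_order_def using finite_orders[of n k f s] by (intro Max_ge) auto
qed

lemma max_order_le:
  assumes "\<And>V E. subgraph_of_complete n V E \<Longrightarrow> k_connected k V E \<Longrightarrow> num_colours f E \<le> s \<Longrightarrow> card V \<le> b"
  shows "max_order f n s k \<le> b"
  unfolding max_order_def using finite_orders[of n k f s] assms by (subst Max_le_iff) auto

lemma max_order_le_order: "max_order f n s k \<le> n"
  using card_mono[of "{1..n}"] by (intro max_order_le) (fastforce simp: subgraph_of_complete_def)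

lemma finite_colourings: "finite (colourings n r)"
  unfolding colourings_def by (intro finite_PiE) auto

lemma min_max_order_le: "f \<in> colourings n r \<Longrightarrow> min_max_order n r s k \<le> max_order f n s k"
  unfolding min_max_order_def by (intro Min_le) (auto simp: finite_colourings)

text \<open>With \<open>1 \<le> r\<close> the constant colouring exists, so \<open>Min\<close> is
  taken over a nonempty finite set.\<close>

lemma min_max_order_attained:
  assumes "1 \<le> r"
  obtains f where "f \<in> colourings n r" "min_max_order n r s k = max_order f n s k"
proof -
  have "restrict (\<lambda>_. 1) (complete_edges {1..n}) \<in> colourings n r"
    unfolding colourings_def using assms by (intro restrict_PiE_iff[THEN iffD2]) auto
  then have "min_max_order n r s k \<in> (\<lambda>f. max_order f n s k) ` colourings n r"
    unfolding min_max_order_def by (intro Min_in) (auto simp: finite_colourings)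
  then show ?thesis using that by auto
qed

lemma colouring_range:
  assumes "f \<in> colourings n r" "x \<in> {1..n}" "y \<in> {1..n}" "x \<noteq> y"
  shows "f {x, y} \<in> {1..r}"
  using assms unfolding colourings_def by (metis PiE_mem doubleton_in_complete_edges)

text \<open>The palette may contain all \<open>r\<close> colours, so the complete graph itself
  qualifies; it is \<open>k\<close>-connected once \<open>k + 1 \<le> n\<close>.\<close>

lemma min_max_order_eq_order:
  assumes "1 \<le> r" "r \<le> s" "k + 1 \<le> n"
  shows "min_max_order n r s k = n"
proof -
  obtain f where f: "f \<in> colourings n r" "min_max_order n r s k = max_order f n s k"
    using min_max_order_attained assms(1) .
  have "{e. f e \<in> {1..r}} \<inter> complete_edges {1..n} = complete_edges {1..n}"
    using f unfolding colourings_def by auto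
  then have "n \<le> max_order f n s k"
    using max_order_ge[of "{1..n}" n k f "{1..r}" s] k_connected_complete[of k "{1..n}"] assms by simp
  with f max_order_le_order[of f n s k] show ?thesis by simp
qed

section \<open>Upper bound: the block colouring\<close>

text \<open>Here \<open>g\<close> sends a vertex to its block, and by \<open>inj\<close> the colour
  of an edge between two blocks determines this pair of blocks. A set \<open>Y\<close> of blocks is
  grown one at a time: connectedness supplies an edge leaving it, whose colour cannot occur inside
  \<open>Y\<close>. So \<open>j + 1\<close> blocks see at least \<open>j\<close> colours.\<close>

lemma card_image_le_num_colours:
  assumes con: "connected_graph V E" and E: "E \<subseteq> complete_edges V" and fin: "finite V"
    and inj: "\<And>e e'. e \<in> E \<Longrightarrow> e' \<in> E \<Longrightarrow> card (g ` e) = 2 \<Longrightarrow> f e' = f e \<Longrightarrow> g ` e' = g ` e"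
  shows "card (g ` V) \<le> num_colours f E + 1"
proof -
  have finE: "finite E" by (rule finite_subset[OF E finite_complete_edges[OF fin]])
  have V: "V \<noteq> {}" using con unfolding connected_graph_def by simp
  have "\<exists>Y\<subseteq>g ` V. card Y = Suc j \<and> j \<le> card (f ` {e \<in> E. g ` e \<subseteq> Y})" if "Suc j \<le> card (g ` V)" for j
    using that
  proof (induction j)
    case 0
    from V obtain v where "v \<in> V" by auto
    then show ?case by (intro exI[of _ "{g v}"]) auto
  next
    case (Suc j)
    then obtain Y where Y: "Y \<subseteq> g ` V" "card Y = Suc j" "j \<le> card (f ` {e \<in> E. g ` e \<subseteq> Y})" by auto
    define X where "X = {v \<in> V. g v \<in> Y}"
    obtain z where "z \<in> Y" using Y(2) by fastforce
    then have "X \<noteq> {}" using Y(1) unfolding X_def by auto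
    moreover have "X \<noteq> V"
    proof
      assume "X = V"
      then have "g ` V \<subseteq> Y" unfolding X_def by auto
      with Y Suc.prems show False by (metis Suc_n_not_le_n subset_antisym)
    qed
    ultimately obtain x y where xy: "x \<in> X" "y \<in> V - X" "{x, y} \<in> E"
      using connected_graph_cutD[OF con E, of X] unfolding X_def by blast
    have gx: "g x \<in> Y" "g y \<notin> Y" using xy unfolding X_def by auto
    let ?Y = "insert (g y) Y"
    have finY: "finite Y" using Y(2) by (simp add: card_ge_0_finite)
    have new: "f {x, y} \<notin> f ` {e \<in> E. g ` e \<subseteq> Y}"
    proof
      assume "f {x, y} \<in> f ` {e \<in> E. g ` e \<subseteq> Y}"
      then obtain e where e: "e \<in> E" "g ` e \<subseteq> Y" "f e = f {x, y}" by auto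
      have "card (g ` {x, y}) = 2" using gx by (auto simp: card_insert_if)
      from inj[OF xy(3) e(1) this e(3)] e(2) gx show False by auto
    qed
    have "insert (f {x, y}) (f ` {e \<in> E. g ` e \<subseteq> Y}) \<subseteq> f ` {e \<in> E. g ` e \<subseteq> ?Y}"
      using xy gx by auto
    then have "card (insert (f {x, y}) (f ` {e \<in> E. g ` e \<subseteq> Y})) \<le> card (f ` {e \<in> E. g ` e \<subseteq> ?Y})"
      using finE by (intro card_mono) auto
    then have "Suc j \<le> card (f ` {e \<in> E. g ` e \<subseteq> ?Y})" using new finE Y(3) by simp
    moreover have "card ?Y = Suc (Suc j)" "?Y \<subseteq> g ` V" using finY gx Y xy by auto
    ultimately show ?case by blast
  qed
  from this[of "card (g ` V) - 1"] V fin obtain Y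
    where "card (g ` V) - 1 \<le> card (f ` {e \<in> E. g ` e \<subseteq> Y})" by (auto simp: Suc_le_eq card_gt_0_iff)
  also have "\<dots> \<le> num_colours f E"
    unfolding num_colours_def using finE by (intro card_mono) auto
  finally show ?thesis by simp
qed

text \<open>The blocks \<open>{i * q + 1..i * q + q}\<close> for \<open>i < t\<close> cover the vertices; each pair of blocks gets
  a private colour, and one further colour is used inside the blocks.\<close>

lemma min_max_order_upper:
  assumes "1 \<le> k" "1 \<le> n" and t: "(t choose 2) + 1 \<le> r" and q: "n \<le> t * q"
  shows "min_max_order n r s k \<le> (s + 1) * q"
proof -
  have q0: "0 < q" using assms(2) q by (cases q) auto
  \<comment> \<open>Vertices are numbered from \<open>1\<close> and blocks from \<open>0\<close>,
    hence the shift.\<close>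
  define g where "g v = (v - 1) div q" for v :: nat
  have g: "g v < t" if "v \<in> {1..n}" for v
    unfolding g_def using that q q0 by (subst div_less_iff_less_mult) auto
  \<comment> \<open>Colour \<open>1\<close> is kept for edges inside blocks; the remaining
    \<open>r - 1\<close> colours suffice for the pairs of blocks.\<close>
  have "card (complete_edges {..<t}) \<le> card {2..r}" using t by (simp add: card_complete_edges)
  then obtain \<phi> where \<phi>: "\<phi> ` complete_edges {..<t} \<subseteq> {2..r}" "inj_on \<phi> (complete_edges {..<t})"
    using card_le_inj[of "complete_edges {..<t}" "{2..r}"] by auto
  define f where "f = restrict (\<lambda>e. if card (g ` e) = 2 then \<phi> (g ` e) else 1) (complete_edges {1..n})"
  have gim: "g ` e \<in> complete_edges {..<t}" if "e \<in> complete_edges {1..n}" "card (g ` e) = 2" for e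
    using that g unfolding complete_edges_def by fastforce
  have \<phi>r: "\<phi> x \<in> {2..r}" if "x \<in> complete_edges {..<t}" for x using \<phi>(1) that by auto
  have "f \<in> colourings n r"
    unfolding colourings_def f_def
  proof (intro restrict_PiE_iff[THEN iffD2] ballI)
    fix e assume e: "e \<in> complete_edges {1..n}"
    show "(if card (g ` e) = 2 then \<phi> (g ` e) else 1) \<in> {1..r}"
      using \<phi>r[OF gim[OF e]] t by auto
  qed
  then have "min_max_order n r s k \<le> max_order f n s k" by (rule min_max_order_le)
  also have "\<dots> \<le> (s + 1) * q"
  proof (rule max_order_le)
    fix V E assume sub: "subgraph_of_complete n V E" and con: "k_connected k V E"
      and col: "num_colours f E \<le> s"
    have V: "V \<subseteq> {1..n}" "finite V" and E: "E \<subseteq> complete_edges V" "E \<subseteq> complete_edges {1..n}"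
      using sub complete_edges_mono[of V "{1..n}"]
      unfolding subgraph_of_complete_def by (auto intro: finite_subset)
    have "connected_graph (V - {}) {e \<in> E. e \<inter> {} = {}}"
      using con assms(1) unfolding k_connected_def by (metis card.empty empty_subsetI less_eq_Suc_le One_nat_def)
    then have "connected_graph V E" by simp
    then have "card (g ` V) \<le> num_colours f E + 1"
    proof (rule card_image_le_num_colours[OF _ E(1) V(2)])
      fix e e' assume e: "e \<in> E" "e' \<in> E" "card (g ` e) = 2" "f e' = f e"
      have f1: "f e = \<phi> (g ` e)" using e E unfolding f_def by auto
      \<comment> \<open>As colour \<open>1\<close> is used only inside blocks, an edge
        \<open>e'\<close> with the colour of \<open>e\<close> must join two blocks as well, and then
        injectivity of \<open>\<phi>\<close> applies.\<close>
      have "f e \<noteq> 1" using f1 \<phi>r[OF gim[of e]] e E by auto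
      then have c': "card (g ` e') = 2" using e E unfolding f_def by (auto split: if_splits)
      then have "f e' = \<phi> (g ` e')" using e E unfolding f_def by auto
      with f1 e(4) have "\<phi> (g ` e') = \<phi> (g ` e)" by simp
      then show "g ` e' = g ` e" using inj_onD[OF \<phi>(2)] gim c' e E by blast
    qed
    then have gV: "card (g ` V) \<le> s + 1" using col by simp
    have "V \<subseteq> (\<Union>i\<in>g ` V. {i * q + 1..i * q + q})"
    proof
      fix v assume v: "v \<in> V"
      have "(v - 1) div q * q + (v - 1) mod q = v - 1" by simp
      moreover have "(v - 1) mod q < q" using q0 by simp
      moreover have "1 \<le> v" using v V by auto
      ultimately have "v \<in> {g v * q + 1..g v * q + q}" unfolding g_def atLeastAtMost_iff by linarith
      with v show "v \<in> (\<Union>i\<in>g ` V. {i * q + 1..i * q + q})" by blast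
    qed
    then have "card V \<le> card (\<Union>i\<in>g ` V. {i * q + 1..i * q + q})"
      using V by (intro card_mono) auto
    also have "\<dots> \<le> (\<Sum>i\<in>g ` V. card {i * q + 1..i * q + q})" using V by (intro card_UN_le) auto
    also have "\<dots> = card (g ` V) * q" by simp
    also have "\<dots> \<le> (s + 1) * q" using gV by (intro mult_le_mono1)
    finally show "card V \<le> (s + 1) * q" .
  qed
  finally show ?thesis .
qed

section \<open>Lower bound: enlarging a largest subgraph with half of the colours\<close>

text \<open>Some colour has at least \<open>(n choose 2) / r = \<gamma> * n\<close> edges for
  \<open>\<gamma> = (n - 1) / (2 * r)\<close>, which exceeds \<open>\<gamma> * (n - k)\<close>. The
  bound on \<open>n\<close> gives \<open>2 * k \<le> \<gamma>\<close>, so Mader's theorem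
  applies.\<close>

lemma monochromatic_k_connected:
  assumes f: "f \<in> colourings n r" and "1 \<le> r" "1 \<le> k" and n: "4 * k * r + 1 \<le> n"
  shows "\<exists>i. \<exists>U\<subseteq>{1..n}. (real n - 1) / (2 * real r) < real (card U) \<and>
    k_connected k U ({e. f e = i} \<inter> complete_edges U)"
proof -
  let ?E = "\<lambda>i. {e. f e = i} \<inter> complete_edges {1..n}"
  let ?\<gamma> = "(real n - 1) / (2 * real r)"
  have "\<exists>i\<in>{1..r}. real (n choose 2) / real r \<le> real (card (?E i))"
  proof (rule ccontr)
    assume "\<not> ?thesis"
    then have "(\<Sum>i\<in>{1..r}. real (card (?E i))) < (\<Sum>i\<in>{1..r}. real (n choose 2) / real r)"
      using assms(2) by (intro sum_strict_mono) (auto simp: not_le)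
    also have "\<dots> = real (n choose 2)" using assms(2) by simp
    also have "\<dots> = real (card (\<Union>i\<in>{1..r}. ?E i))"
    proof -
      have "(\<Union>i\<in>{1..r}. ?E i) = complete_edges {1..n}" using f unfolding colourings_def by auto
      then show ?thesis by (simp add: card_complete_edges)
    qed
    also have "\<dots> = (\<Sum>i\<in>{1..r}. real (card (?E i)))"
      by (subst card_UN_disjoint) auto
    finally show False by simp
  qed
  then obtain i where i: "real (n choose 2) / real r \<le> real (card (?E i))" by blast
  have kr: "k \<le> k * r" using assms by simp
  have "real (4 * k * r + 1) \<le> real n" using n by (rule of_nat_mono)
  then have \<gamma>: "2 * real k \<le> ?\<gamma>" using assms(2) by (simp add: field_simps)
  moreover have "2 * k \<le> card {1..n}"
  proof -
    have "4 * (k * r) + 1 \<le> n" using n by (simp add: mult.assoc)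
    then have "2 * k \<le> n" using kr by linarith
    then show ?thesis by simp
  qed
  moreover have "?\<gamma> * (real (card {1..n}) - real k) < real (card (?E i))"
  proof -
    have "?\<gamma> * (real n - real k) < ?\<gamma> * real n" using \<gamma> assms(3) by (intro mult_strict_left_mono) auto
    also have "\<dots> = real (n choose 2) / real r" by (simp add: real_choose_two)
    finally show ?thesis using i by simp
  qed
  ultimately show ?thesis
    using mader_k_connected_subgraph[of "{1..n}" k ?\<gamma> "{e. f e = i}"] assms by auto
qed

lemma nat_ceiling_half: "nat \<lceil>real s / 2\<rceil> = (s + 1) div 2"
proof -
  obtain m where "s = 2 * m \<or> s = 2 * m + 1" by (metis evenE oddE)
  then have "\<lceil>real s / 2\<rceil> = int ((s + 1) div 2)"
    by (intro ceiling_unique) (auto simp: field_simps)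
  then show ?thesis by simp
qed

lemma max_order_lower:
  assumes f: "f \<in> colourings n r" and pos: "1 \<le> r" "1 \<le> s" "1 \<le> k" and "s < r"
    and n: "16 * k * r ^ 2 + 4 * k * r \<le> n"
  shows "(1 - exp (- (real s ^ 2 / (4 * real r)))) * real n
      - 2 * real k * real r * real (r choose ((s + 1) div 2)) \<le> real (max_order f n s k)"
proof -
  define p where "p = exp (- (real s ^ 2 / (4 * real r)))"
  have p: "0 < p" "p \<le> 1" unfolding p_def by auto
  have kr: "k \<le> k * r" "1 \<le> k * r" using pos by auto
  have "1 \<le> 16 * k * r ^ 2" using pos by (simp add: Suc_le_eq)
  then have "4 * k * r + 1 \<le> n" using n by linarith
  from monochromatic_k_connected[OF f pos(1,3) this] obtain i U where
    U: "U \<subseteq> {1..n}" "(real n - 1) / (2 * real r) < real (card U)"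
      "k_connected k U ({e. f e \<in> {i}} \<inter> complete_edges U)" by auto
  show ?thesis
  \<comment> \<open>For \<open>s = 1\<close> half of the colours, rounded down, is none. Here
    \<open>1 - p \<le> 1 / (4 * r)\<close> by \<open>exp x \<ge> 1 + x\<close>, while
    \<open>U\<close> has more than \<open>(n - 1) / (2 * r) \<ge> n / (4 * r)\<close> vertices, as
    \<open>n \<ge> 2\<close>.\<close>
  proof (cases "s = 1")
    case True
    have "1 - p \<le> 1 / (4 * real r)"
      using exp_ge_add_one_self[of "- (1 / (4 * real r))"] True unfolding p_def by simp
    then have "(1 - p) * real n \<le> 1 / (4 * real r) * real n" by (intro mult_right_mono) auto
    also have "\<dots> \<le> (real n - 1) / (2 * real r)"
    proof -
      have "4 * (k * r) + 1 \<le> n" using \<open>4 * k * r + 1 \<le> n\<close> by (simp add: mult.assoc)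
      then have "2 \<le> n" using kr by linarith
      then have "2 \<le> real n" by simp
      then show ?thesis using pos by (simp add: field_simps)
    qed
    also have "\<dots> \<le> real (card U)" using U by simp
    also have "\<dots> \<le> real (max_order f n s k)"
      using max_order_ge[OF U(1,3)] pos by simp
    finally have "(1 - p) * real n \<le> real (max_order f n s k)" .
    moreover have "0 \<le> 2 * real k * real r * real (r choose ((s + 1) div 2))" by simp
    ultimately show ?thesis unfolding p_def by linarith
  next
    case False
    \<comment> \<open>\<open>a\<close> colours are spent on \<open>H\<close> and \<open>c\<close> on
      joining vertices to it, \<open>s\<close> in total. By \<open>c - 1 \<le> a\<close> a subgraph
      with \<open>c - 1\<close> colours competes with \<open>H\<close>; \<open>2 * c \<le> r\<close>
      places \<open>c\<close> where binomial coefficients still increase.\<close>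
    define a c where "a = s div 2" and "c = (s + 1) div 2"
    have ac: "1 \<le> a" "1 \<le> c" "a + c = s" "c - 1 \<le> a" "2 * c \<le> r" "s \<le> 2 * c"
      using False pos \<open>s < r\<close> unfolding a_def c_def by auto
    define P where "P V \<longleftrightarrow> V \<subseteq> {1..n} \<and>
      (\<exists>C. finite C \<and> card C \<le> a \<and> k_connected k V ({e. f e \<in> C} \<inter> complete_edges V))" for V
    have PU: "P U" unfolding P_def using U ac by (intro conjI exI[of _ "{i}"]) auto
    have "\<forall>V. P V \<longrightarrow> card V < Suc n"
      using card_mono[of "{1..n}"] unfolding P_def by (fastforce simp: less_Suc_eq_le)
    then obtain H where H: "P H" "\<And>V. P V \<Longrightarrow> card V \<le> card H"
      using ex_has_greatest_nat[of P U card "Suc n"] PU by auto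
    then obtain D where HD: "H \<subseteq> {1..n}" "finite D" "card D \<le> a"
        "k_connected k H ({e. f e \<in> D} \<inter> complete_edges H)" unfolding P_def by auto
    have finH: "finite H" using HD(1) by (rule finite_subset) simp
    \<comment> \<open>\<open>H\<close> is at least as large as \<open>U\<close>, so
      \<open>n \<le> 2 * r * card H\<close>, and the bound on \<open>n\<close> is
      \<open>2 * r\<close> times \<open>8 * k * r + 2 * k\<close>.\<close>
    have big: "4 * (k * r) + k \<le> card H"
    proof -
      have "card U \<le> card H" using H PU by simp
      then have "(real n - 1) / (2 * real r) < real (card H)" using U(2) by linarith
      then have "real n < 2 * real r * real (card H) + 1" using pos by (simp add: field_simps)
      then have "n \<le> 2 * r * card H"
        by (metis (mono_tags, lifting) of_nat_1 of_nat_add of_nat_less_iff of_nat_mult of_nat_numeral less_Suc_eq_le Suc_eq_plus1)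
      then have "2 * r * (8 * k * r + 2 * k) \<le> 2 * r * card H"
        using n by (simp add: power2_eq_square algebra_simps)
      then have "8 * k * r + 2 * k \<le> card H" using pos by simp
      then show ?thesis by simp
    qed
    \<comment> \<open>The colours in which \<open>u\<close> alone could be joined to
      \<open>H\<close> by \<open>k_connected_extend\<close>.\<close>
    define col where "col u = {i \<in> {1..r}. k \<le> card {x \<in> H. f {u, x} = i}}" for u
    define T where "T = {1..n} - H"
    define Bad where "Bad = {u \<in> T. card (col u) < c}"
    have finT: "finite T" unfolding T_def by simp
    have colr: "col u \<subseteq> {1..r}" for u unfolding col_def by auto
    \<comment> \<open>Each of the at most \<open>r\<close> colours outside \<open>Q\<close> occurs
      on fewer than \<open>k\<close> edges from \<open>w\<close> to \<open>H\<close>, so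
      \<open>bipartite_k_connected\<close> applies with \<open>d = k * r\<close>. The subgraph it
      yields is larger than \<open>H\<close> and contradicts maximality.\<close>
    have class_bound: "card {u \<in> T. col u \<subseteq> Q} \<le> 2 * (k * r)" if Q: "Q \<subseteq> {1..r}" "card Q = c - 1" for Q
    proof (rule ccontr)
      assume contra: "\<not> ?thesis"
      define W where "W = {u \<in> T. col u \<subseteq> Q}"
      have W: "finite W" "W \<subseteq> {1..n}" "H \<inter> W = {}" "2 * (k * r) < card W"
        using contra finT unfolding W_def T_def by auto
      have "card {x \<in> H. {w, x} \<notin> {e. f e \<in> Q}} \<le> k * r" if w: "w \<in> W" for w
      proof -
        have "{x \<in> H. {w, x} \<notin> {e. f e \<in> Q}} \<subseteq> (\<Union>i\<in>{1..r} - Q. {x \<in> H. f {w, x} = i})"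
        proof
          fix x assume x: "x \<in> {x \<in> H. {w, x} \<notin> {e. f e \<in> Q}}"
          with W HD w have "w \<in> {1..n}" "x \<in> {1..n}" "w \<noteq> x" by blast+
          then have "f {w, x} \<in> {1..r}" by (rule colouring_range[OF f])
          with x show "x \<in> (\<Union>i\<in>{1..r} - Q. {x \<in> H. f {w, x} = i})" by auto
        qed
        then have "card {x \<in> H. {w, x} \<notin> {e. f e \<in> Q}} \<le> card (\<Union>i\<in>{1..r} - Q. {x \<in> H. f {w, x} = i})"
          using finH by (intro card_mono) auto
        also have "\<dots> \<le> (\<Sum>i\<in>{1..r} - Q. card {x \<in> H. f {w, x} = i})" by (intro card_UN_le) auto
        also have "\<dots> \<le> (\<Sum>i\<in>{1..r} - Q. k)"
        proof (rule sum_mono)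
          fix i assume i: "i \<in> {1..r} - Q"
          have "col w \<subseteq> Q" using w unfolding W_def by simp
          with i have "i \<notin> col w" by auto
          with i show "card {x \<in> H. f {w, x} = i} \<le> k" unfolding col_def by auto
        qed
        also have "\<dots> \<le> r * k" using card_mono[of "{1..r}" "{1..r} - Q"] by simp
        finally show ?thesis by (simp add: mult.commute)
      qed
      from bipartite_k_connected[OF finH W(1,3) this pos(3) kr(1) W(4) big] obtain A where
        A: "A \<subseteq> H" "card H \<le> card A + 2 * (k * r)"
          "k_connected k (A \<union> W) ({e. f e \<in> Q} \<inter> complete_edges (A \<union> W))" by auto
      have "finite Q" using Q(1) by (rule finite_subset) simp
      then have "P (A \<union> W)"
        unfolding P_def using A HD(1) W(2) Q(2) ac(4) by (intro conjI exI[of _ Q]) auto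
      then have "card (A \<union> W) \<le> card H" by (rule H(2))
      moreover have "card (A \<union> W) = card A + card W"
        using A(1) W finH by (intro card_Un_disjoint) (auto intro: finite_subset)
      ultimately show False using A(2) W(4) by linarith
    qed
    \<comment> \<open>For a bad \<open>u\<close>, \<open>col u\<close> extends to a set of exactly
      \<open>c - 1\<close> colours, so the bad vertices are covered by
      \<open>r choose (c - 1)\<close> classes, each bounded by \<open>class_bound\<close>.\<close>
    have cardBad: "card Bad \<le> 2 * (k * r) * (r choose c)"
    proof -
      let ?Q = "{Q. Q \<subseteq> {1..r} \<and> card Q = c - 1}"
      have finQ: "finite ?Q" by (rule finite_subset[of _ "Pow {1..r}"]) auto
      have "Bad \<subseteq> (\<Union>Q\<in>?Q. {u \<in> T. col u \<subseteq> Q})"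
      proof
        fix u assume u: "u \<in> Bad"
        have "card (col u) \<le> c - 1" "c - 1 \<le> card {1..r}" using u ac unfolding Bad_def by auto
        from exists_subset_between[OF this colr] obtain Q
          where "col u \<subseteq> Q" "Q \<subseteq> {1..r}" "card Q = c - 1" by auto
        with u show "u \<in> (\<Union>Q\<in>?Q. {u \<in> T. col u \<subseteq> Q})" unfolding Bad_def by auto
      qed
      then have "card Bad \<le> card (\<Union>Q\<in>?Q. {u \<in> T. col u \<subseteq> Q})"
        using finQ finT by (intro card_mono) auto
      also have "\<dots> \<le> (\<Sum>Q\<in>?Q. card {u \<in> T. col u \<subseteq> Q})" using finQ by (intro card_UN_le)
      also have "\<dots> \<le> (\<Sum>Q\<in>?Q. 2 * (k * r))" using class_bound by (intro sum_mono) auto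
      also have "\<dots> = 2 * (k * r) * (r choose (c - 1))"
        using n_subsets[of "{1..r}" "c - 1"] by (simp add: mult.commute)
      also have "\<dots> \<le> 2 * (k * r) * (r choose c)"
        using ac by (intro mult_le_mono2 binomial_mono) auto
      finally show ?thesis .
    qed
    define Good where "Good = T - Bad"
    have "\<exists>C\<subseteq>{1..r}. card C \<le> c \<and>
      real (card {u \<in> Good. col u \<inter> C = {}}) \<le> (1 - real c / real (card {1..r})) ^ c * real (card Good)"
      using pos colr ac finT unfolding Good_def Bad_def by (intro greedy_cover) auto
    then obtain C where C: "C \<subseteq> {1..r}" "card C \<le> c"
      "real (card {u \<in> Good. col u \<inter> C = {}}) \<le> (1 - real c / real r) ^ c * real (card Good)" by auto
    have finC: "finite C" using C(1) by (rule finite_subset) simp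
    \<comment> \<open>This is \<open>1 - x \<le> exp (- x)\<close> for \<open>x = c / r\<close>,
      raised to the power \<open>c\<close>; then \<open>s \<le> 2 * c\<close> turns c^2/r into
      s^2/(4r).\<close>
    have "(1 - real c / real r) ^ c \<le> exp (- (real c / real r)) ^ c"
      using exp_ge_add_one_self[of "- (real c / real r)"] ac pos by (intro power_mono) (auto simp: field_simps)
    also have "\<dots> = exp (- (real c ^ 2 / real r))"
      by (simp add: exp_of_nat_mult[symmetric] power2_eq_square)
    also have "\<dots> \<le> p"
    proof -
      have "real s ^ 2 \<le> (2 * real c) ^ 2" using ac by (intro power_mono) auto
      then show ?thesis unfolding p_def using pos by (simp add: field_simps)
    qed
    finally have miss: "real (card {u \<in> Good. col u \<inter> C = {}}) \<le> p * real (card Good)"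
      using C(3) by (meson mult_right_mono of_nat_0_le_iff order_trans)
    define Hit where "Hit = {u \<in> Good. col u \<inter> C \<noteq> {}}"
    have fins: "finite Good" "finite Hit" "finite Bad"
      using finT unfolding Good_def Hit_def Bad_def by auto
    have "k_connected k (H \<union> Hit) ({e. f e \<in> D \<union> C} \<inter> complete_edges (H \<union> Hit))"
    proof (rule k_connected_extend[OF HD(4)])
      fix u assume "u \<in> Hit"
      then obtain i where i: "i \<in> C" "k \<le> card {x \<in> H. f {u, x} = i}"
        unfolding Hit_def col_def by auto
      note i(2)
      also have "card {x \<in> H. f {u, x} = i} \<le> card {x \<in> H. {u, x} \<in> {e. f e \<in> D \<union> C}}"
        using finH i(1) by (intro card_mono) auto
      finally show "k \<le> card {x \<in> H. {u, x} \<in> {e. f e \<in> D \<union> C}}" .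
    qed (use fins in auto)
    moreover have "H \<union> Hit \<subseteq> {1..n}" using HD unfolding Hit_def Good_def T_def by auto
    moreover have "card (D \<union> C) \<le> s" using card_Un_le[of D C] HD(3) C(2) ac by linarith
    ultimately have le: "card (H \<union> Hit) \<le> max_order f n s k"
      using HD(2) finC by (intro max_order_ge) auto
    have "card (H \<union> Hit) = card H + card Hit"
      using fins finH unfolding Hit_def Good_def T_def by (intro card_Un_disjoint) auto
    moreover have "card Good = card Hit + card {u \<in> Good. col u \<inter> C = {}}"
      using fins unfolding Hit_def by (subst card_Un_disjoint[symmetric]) (auto intro!: arg_cong[where f = card])
    moreover have "card Good + card Bad = card T"
      using fins unfolding Good_def Bad_def by (subst card_Un_disjoint[symmetric]) (auto intro!: arg_cong[where f = card])
    moreover have "card T + card H = n"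
      using finH finT HD(1) unfolding T_def by (subst card_Un_disjoint[symmetric]) (auto simp: Un_absorb2)
    ultimately have eqs: "real (max_order f n s k) \<ge> real (card H) + (real (card Good) - real (card {u \<in> Good. col u \<inter> C = {}}))"
      "real (card Good) = real n - real (card H) - real (card Bad)" using le by linarith+
    \<comment> \<open>The right side exceeds the left by \<open>p * (card H + card Bad)\<close>: the
      vertices of \<open>H\<close> are counted in full, and bad vertices cost at most one
      each.\<close>
    have "(1 - p) * real n - real (card Bad) \<le> real (card H) + (1 - p) * (real n - real (card H) - real (card Bad))"
    proof -
      have "0 \<le> p * (real (card H) + real (card Bad))" using p by simp
      then show ?thesis by (simp add: algebra_simps)
    qed
    also have "\<dots> \<le> real (max_order f n s k)"
      using eqs(1) miss unfolding eqs(2)[symmetric] by (simp add: algebra_simps)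
    finally have "(1 - p) * real n - real (card Bad) \<le> real (max_order f n s k)" .
    moreover have "real (card Bad) \<le> real (2 * (k * r) * (r choose c))"
      using cardBad by (rule of_nat_mono)
    ultimately show ?thesis unfolding p_def c_def by simp
  qed
qed

section \<open>The two bounds for the minimum over colourings\<close>

lemma min_max_order_le_order: "1 \<le> r \<Longrightarrow> min_max_order n r s k \<le> n"
  by (metis min_max_order_attained max_order_le_order)

text \<open>The quadratic bound on \<open>n\<close> is asked only for \<open>s < r\<close>, since
  for \<open>r \<le> s\<close> the value is \<open>n\<close>. The limit argument relies on this
  form, as it derives that bound only when \<open>s < r\<close>.\<close>

lemma min_max_order_lower_bound:
  assumes "1 \<le> r" "1 \<le> s" "1 \<le> k" and n: "k + 1 \<le> n" "s < r \<Longrightarrow> 16 * k * r ^ 2 + 4 * k * r \<le> n"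
  shows "(1 - exp (- (real s ^ 2 / (4 * real r)))) * real n
      - 2 * real k * real r * real (r choose nat \<lceil>real s / 2\<rceil>) \<le> real (min_max_order n r s k)"
proof (cases "s < r")
  case True
  obtain f where "f \<in> colourings n r" "min_max_order n r s k = max_order f n s k"
    using min_max_order_attained assms(1) .
  then show ?thesis
    using max_order_lower[of f n r s k] assms True unfolding nat_ceiling_half by simp
next
  case False
  then have "min_max_order n r s k = n" using assms by (intro min_max_order_eq_order) auto
  moreover have "(1 - exp (- (real s ^ 2 / (4 * real r)))) * real n \<le> 1 * real n"
    by (intro mult_right_mono) auto
  moreover have "0 \<le> 2 * real k * real r * real (r choose nat \<lceil>real s / 2\<rceil>)" by simp
  ultimately show ?thesis by linarith
qed

text \<open>With \<open>t\<close> blocks, t^2 \<le> 2r gives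
  \<open>t choose 2 \<le> r - t / 2\<close>, which leaves a colour for the inside of the blocks once
  \<open>t \<ge> 2\<close>; for \<open>t = 1\<close> a single colour is enough.\<close>

lemma min_max_order_upper_bound:
  assumes "1 \<le> r" "1 \<le> k" "1 \<le> n"
  shows "real (min_max_order n r s k)
    \<le> (real s + 1) * real_of_int \<lceil>real n / real_of_int \<lfloor>sqrt (2 * real r)\<rfloor>\<rceil>"
proof -
  define t where "t = nat \<lfloor>sqrt (2 * real r)\<rfloor>"
  define q where "q = nat \<lceil>real n / real t\<rceil>"
  have "1 \<le> sqrt (2 * real r)" using assms(1) by simp
  then have t1: "1 \<le> \<lfloor>sqrt (2 * real r)\<rfloor>" by simp
  then have t: "1 \<le> t" "real t = real_of_int \<lfloor>sqrt (2 * real r)\<rfloor>" unfolding t_def by linarith+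
  have q: "real q = real_of_int \<lceil>real n / real t\<rceil>" unfolding q_def by simp
  have "real t \<le> sqrt (2 * real r)" unfolding t(2) by simp
  then have "real t ^ 2 \<le> sqrt (2 * real r) ^ 2" by (intro power_mono) auto
  then have tt: "real t ^ 2 \<le> 2 * real r" by simp
  have "real ((t choose 2) + 1) \<le> real r"
  proof (cases "t = 1")
    case False
    then have "2 \<le> real t" using t(1) by simp
    moreover have "real (t choose 2) = (real t ^ 2 - real t) / 2"
      by (simp add: real_choose_two power2_eq_square algebra_simps)
    ultimately show ?thesis using tt by simp
  qed (use assms in \<open>simp add: binomial_eq_0\<close>)
  then have tr: "(t choose 2) + 1 \<le> r" by (simp only: of_nat_le_iff)
  have "real n / real t \<le> real q" unfolding q by simp
  then have "real n \<le> real (t * q)" using t(1) by (simp add: field_simps)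
  then have "n \<le> t * q" by (simp only: of_nat_le_iff)
  from min_max_order_upper[OF assms(2,3) tr this]
  have "real (min_max_order n r s k) \<le> real ((s + 1) * q)" by (rule of_nat_mono)
  then have "real (min_max_order n r s k) \<le> (real s + 1) * real q"
    by (simp only: of_nat_mult of_nat_add of_nat_1)
  then show ?thesis by (simp only: q t(2))
qed

section \<open>Limits of the ratio\<close>

text \<open>The upper bound is at most \<open>6 * s / sqrt r\<close> times \<open>n\<close>:
  \<open>s + 1 \<le> 2 * s\<close>, and the rounded block size is at most
  \<open>3 * n / sqrt r\<close>.\<close>

lemma min_max_order_ratio_tendsto_0:
  fixes n s k :: "nat \<Rightarrow> nat"
  assumes pos: "\<forall>\<^sub>F r in sequentially. 1 \<le> n r \<and> 1 \<le> s r \<and> 1 \<le> k r"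
    and large: "(\<lambda>r. real (k r) * real r * real (r choose nat \<lceil>real (s r) / 2\<rceil>)) \<lless> (\<lambda>r. real (n r))"
    and small: "(\<lambda>r. real (s r)) \<lless> (\<lambda>r. sqrt (real r))"
  shows "(\<lambda>r. real (min_max_order (n r) r (s r) (k r)) / real (n r)) \<longlonglongrightarrow> 0"
proof (rule tendsto_sandwich[of "\<lambda>_. 0" _ _ "\<lambda>r. 6 * (real (s r) / sqrt (real r))"])
  have lim: "(\<lambda>r. real (s r) / sqrt (real r)) \<longlonglongrightarrow> 0" using small unfolding much_less_def .
  have ev1: "\<forall>\<^sub>F r in sequentially. real (s r) / sqrt (real r) < 1"
    using lim by (rule order_tendstoD) simp
  have ev2: "\<forall>\<^sub>F r in sequentially. real (k r) * real r * real (r choose nat \<lceil>real (s r) / 2\<rceil>) / real (n r) < 1"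
    using large unfolding much_less_def by (rule order_tendstoD) simp
  show "\<forall>\<^sub>F r in sequentially. real (min_max_order (n r) r (s r) (k r)) / real (n r) \<le> 6 * (real (s r) / sqrt (real r))"
    using pos ev1 ev2 eventually_ge_at_top[of 1]
  proof eventually_elim
    case (elim r)
    let ?x = "sqrt (real r)"
    have x: "1 \<le> ?x" "?x * ?x = real r" using elim by auto
    \<comment> \<open>Since \<open>s < sqrt r \<le> r\<close>, the binomial coefficient is positive,
      so \<open>large\<close> forces \<open>r \<le> n\<close>. This lets the rounding error of
      \<open>1\<close> be absorbed into \<open>n / sqrt r\<close>.\<close>
    have "real (s r) < ?x" using elim x by (simp add: field_simps)
    moreover have "?x * 1 \<le> ?x * ?x" using x(1) by (intro mult_left_mono) auto
    ultimately have "real (s r) < real r" using x by linarith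
    then have "(s r + 1) div 2 \<le> r" by simp
    then have c: "1 \<le> real (r choose nat \<lceil>real (s r) / 2\<rceil>)"
      unfolding nat_ceiling_half by (simp add: Suc_le_eq)
    have "1 * real r \<le> real (k r) * real r" using elim by (intro mult_right_mono) auto
    also have "\<dots> = real (k r) * real r * 1" by simp
    also have "\<dots> \<le> real (k r) * real r * real (r choose nat \<lceil>real (s r) / 2\<rceil>)"
      using c by (intro mult_left_mono) auto
    also have "\<dots> \<le> real (n r)" using elim by (simp add: field_simps)
    finally have rn: "real r \<le> real (n r)" by simp
    \<comment> \<open>Since \<open>sqrt r < t + 1 \<le> 2 * t\<close>, rounding down costs at most a
      factor \<open>2\<close>.\<close>
    define t where "t = real_of_int \<lfloor>sqrt (2 * real r)\<rfloor>"
    have "?x \<le> sqrt (2 * real r)" by simp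
    moreover have "sqrt (2 * real r) < t + 1" unfolding t_def by linarith
    moreover have "1 \<le> t" using calculation(1) x(1) unfolding t_def by simp
    ultimately have t: "?x / 2 \<le> t" "1 \<le> t" by linarith+
    have "real (min_max_order (n r) r (s r) (k r)) \<le> (real (s r) + 1) * real_of_int \<lceil>real (n r) / t\<rceil>"
      unfolding t_def using elim by (intro min_max_order_upper_bound) auto
    also have "\<dots> \<le> (2 * real (s r)) * (real (n r) / t + 1)"
    proof (intro mult_mono)
      have "0 \<le> real (n r) / t" using t by simp
      then show "0 \<le> real_of_int \<lceil>real (n r) / t\<rceil>" by linarith
    qed (use elim in auto)
    also have "\<dots> \<le> (2 * real (s r)) * (real (n r) * 3 / ?x)"
    proof (intro mult_left_mono)
      define y where "y = real (n r) / ?x"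
      have "real (n r) / t \<le> real (n r) / (?x / 2)" using t x by (intro divide_left_mono) auto
      also have "\<dots> = 2 * y" by (simp add: y_def)
      finally have "real (n r) / t \<le> 2 * y" .
      moreover have "1 \<le> y" unfolding y_def using rn x \<open>?x * 1 \<le> ?x * ?x\<close> by (simp add: field_simps)
      moreover have "real (n r) * 3 / ?x = 3 * y" by (simp add: y_def)
      ultimately show "real (n r) / t + 1 \<le> real (n r) * 3 / ?x" by linarith
    qed simp
    finally show ?case using elim x by (simp add: field_simps)
  qed
  show "(\<lambda>r. 6 * (real (s r) / sqrt (real r))) \<longlonglongrightarrow> 0"
    using tendsto_mult_left[OF lim, of 6] by simp
qed simp_all

text \<open>After division by \<open>n\<close>, both error terms of the lower bound tend to
  \<open>0\<close>, and the ratio is at most \<open>1\<close>. The assumption \<open>huge\<close>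
  concerns the range \<open>2 * r < s\<close>, where the binomial coefficient is \<open>0\<close>
  and \<open>large\<close> says nothing about the size of \<open>n\<close>.\<close>

lemma min_max_order_ratio_tendsto_1:
  fixes n s k :: "nat \<Rightarrow> nat"
  assumes pos: "\<forall>\<^sub>F r in sequentially. 1 \<le> n r \<and> 1 \<le> s r \<and> 1 \<le> k r"
    and huge: "\<forall>\<^sub>F r in sequentially. 2 * r < s r \<longrightarrow> 16 * k r * r ^ 2 + 4 * k r * r \<le> n r"
    and large: "(\<lambda>r. real (k r) * real r * real (r choose nat \<lceil>real (s r) / 2\<rceil>)) \<lless> (\<lambda>r. real (n r))"
    and big: "(\<lambda>r. sqrt (real r)) \<lless> (\<lambda>r. real (s r))"
  shows "(\<lambda>r. real (min_max_order (n r) r (s r) (k r)) / real (n r)) \<longlonglongrightarrow> 1"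
proof (rule tendsto_sandwich)
  let ?q = "\<lambda>r. real (k r) * real r * real (r choose nat \<lceil>real (s r) / 2\<rceil>) / real (n r)"
  let ?l = "\<lambda>r. 1 - exp (- (1 / 4 * (real (s r) / sqrt (real r)) ^ 2)) - 2 * ?q r"
  have limq: "?q \<longlonglongrightarrow> 0" using large unfolding much_less_def .
  \<comment> \<open>The constant is \<open>16 + 4\<close>: for \<open>s < r\<close> the binomial
    coefficient is at least \<open>r\<close>, so \<open>20 * k * r * b < n\<close> gives the
    quadratic bound on \<open>n\<close>.\<close>
  then have ev: "\<forall>\<^sub>F r in sequentially. ?q r < 1 / 20" by (rule order_tendstoD) simp
  \<comment> \<open>Positivity makes the quotient tend to \<open>0\<close> from the right, so its
    inverse tends to infinity.\<close>
  have "\<forall>\<^sub>F r in sequentially. 0 < sqrt (real r) / real (s r)"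
    using pos eventually_gt_at_top[of 0] by eventually_elim simp
  with big have "filterlim (\<lambda>r. sqrt (real r) / real (s r)) (at_right 0) sequentially"
    unfolding much_less_def by (intro tendsto_imp_filterlim_at_right) auto
  then have "filterlim (\<lambda>r. real (s r) / sqrt (real r)) at_top sequentially"
    using filterlim_compose[OF filterlim_inverse_at_top_right] by fastforce
  then have "filterlim (\<lambda>r. (real (s r) / sqrt (real r)) ^ 2) at_top sequentially"
    by (rule filterlim_pow_at_top[rotated]) simp
  then have "filterlim (\<lambda>r. 1 / 4 * (real (s r) / sqrt (real r)) ^ 2) at_top sequentially"
    by (intro filterlim_tendsto_pos_mult_at_top[OF tendsto_const]) auto
  then have "(\<lambda>r. exp (- (1 / 4 * (real (s r) / sqrt (real r)) ^ 2))) \<longlonglongrightarrow> 0"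
    by (intro filterlim_compose[OF exp_at_bot] filterlim_compose[OF filterlim_uminus_at_bot_at_top])
  then have "?l \<longlonglongrightarrow> 1 - 0 - 2 * 0" using limq by (intro tendsto_intros)
  then show "?l \<longlonglongrightarrow> 1" by simp
  show "\<forall>\<^sub>F r in sequentially. ?l r \<le> real (min_max_order (n r) r (s r) (k r)) / real (n r)"
    using pos huge ev eventually_ge_at_top[of 2]
  proof eventually_elim
    case (elim r)
    define b where "b = (r choose nat \<lceil>real (s r) / 2\<rceil>)"
    have "real (k r * r * b) * 20 < real (n r)" using elim unfolding b_def by (simp add: field_simps)
    then have "real (k r * r * b * 20) < real (n r)" by simp
    then have nb: "20 * (k r * r * b) < n r" by (simp only: of_nat_less_iff)
    have b1: "1 \<le> b" if "s r \<le> 2 * r"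
      using that unfolding b_def nat_ceiling_half by (simp add: Suc_le_eq)
    have "k r + 1 \<le> n r"
    proof (cases "s r \<le> 2 * r")
      case True
      have "k r * 1 * 1 \<le> k r * r * b" using elim b1[OF True] by (intro mult_le_mono) auto
      with nb elim show ?thesis by linarith
    next
      case False
      then have "16 * (k r * r ^ 2) + 4 * (k r * r) \<le> n r" using elim by (simp add: mult.assoc)
      moreover have "k r * 1 \<le> k r * r" using elim by (intro mult_le_mono) auto
      ultimately show ?thesis using elim by linarith
    qed
    moreover have "16 * k r * r ^ 2 + 4 * k r * r \<le> n r" if sr: "s r < r"
    proof -
      let ?c = "(s r + 1) div 2"
      have "r choose 1 \<le> r choose ?c" using elim sr by (intro binomial_mono) auto
      then have "r \<le> b" unfolding b_def nat_ceiling_half by simp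
      then have "k r * r * r \<le> k r * r * b" by (rule mult_le_mono2)
      moreover have "k r * r * 1 \<le> k r * r * r" using elim by (intro mult_le_mono) auto
      ultimately have "16 * (k r * r * r) + 4 * (k r * r) \<le> n r" using nb by linarith
      then show ?thesis by (simp add: power2_eq_square mult.assoc)
    qed
    ultimately have "(1 - exp (- (real (s r) ^ 2 / (4 * real r)))) * real (n r)
        - 2 * real (k r) * real r * real b \<le> real (min_max_order (n r) r (s r) (k r))"
      unfolding b_def using elim by (intro min_max_order_lower_bound) auto
    then have "((1 - exp (- (real (s r) ^ 2 / (4 * real r)))) * real (n r)
        - 2 * real (k r) * real r * real b) / real (n r) \<le> real (min_max_order (n r) r (s r) (k r)) / real (n r)"
      by (rule divide_right_mono) simp
    moreover have "((1 - exp (- (real (s r) ^ 2 / (4 * real r)))) * real (n r)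
        - 2 * real (k r) * real r * real b) / real (n r) = ?l r"
      using elim unfolding b_def by (simp add: power_divide diff_divide_distrib)
    ultimately show ?case by linarith
  qed
  show "\<forall>\<^sub>F r in sequentially. real (min_max_order (n r) r (s r) (k r)) / real (n r) \<le> 1"
    using pos eventually_ge_at_top[of 1]
  proof eventually_elim
    case (elim r)
    then show ?case using min_max_order_le_order[of r "n r" "s r" "k r"] by simp
  qed
qed simp

theorem theorem1p5:
  shows "(\<forall>n r s k :: nat.
            1 \<le> n \<and> 1 \<le> r \<and> 1 \<le> s \<and> 1 \<le> k \<and> 16 * k * r ^ 2 + 4 * k * r \<le> n \<longrightarrow>
              (1 - exp (- (real s ^ 2 / (4 * real r)))) * real n
                 - 2 * real k * real r * real (r choose nat \<lceil>real s / 2\<rceil>)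
                \<le> real (min_max_order n r s k) \<and>
              real (min_max_order n r s k)
                \<le> (real s + 1) * real_of_int \<lceil>real n / real_of_int \<lfloor>sqrt (2 * real r)\<rfloor>\<rceil>)
       \<and>
         (\<forall>n s k :: nat \<Rightarrow> nat.
            (\<forall>\<^sub>F r in sequentially. 1 \<le> n r \<and> 1 \<le> s r \<and> 1 \<le> k r) \<and>
            (\<forall>\<^sub>F r in sequentially. 2 * r < s r \<longrightarrow> 16 * k r * r ^ 2 + 4 * k r * r \<le> n r) \<and>
            (\<lambda>r. real (k r) * real r * real (r choose nat \<lceil>real (s r) / 2\<rceil>)) \<lless> (\<lambda>r. real (n r)) \<longrightarrow>
              ((\<lambda>r. real (s r)) \<lless> (\<lambda>r. sqrt (real r)) \<longrightarrow>
                 (\<lambda>r. real (min_max_order (n r) r (s r) (k r)) / real (n r)) \<longlonglongrightarrow> 0) \<and>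
              ((\<lambda>r. sqrt (real r)) \<lless> (\<lambda>r. real (s r)) \<longrightarrow>
                 (\<lambda>r. real (min_max_order (n r) r (s r) (k r)) / real (n r)) \<longlonglongrightarrow> 1))"
proof (intro conjI allI impI; (elim conjE)?)
  fix n r s k :: nat
  assume a: "1 \<le> n" "1 \<le> r" "1 \<le> s" "1 \<le> k" "16 * k * r ^ 2 + 4 * k * r \<le> n"
  have "k * 1 \<le> k * r" "1 \<le> k * r" using a by auto
  moreover have "4 * (k * r) \<le> n" using a(5) by (simp add: mult.assoc)
  ultimately have "k + 1 \<le> n" by linarith
  with a show "(1 - exp (- (real s ^ 2 / (4 * real r)))) * real n
      - 2 * real k * real r * real (r choose nat \<lceil>real s / 2\<rceil>) \<le> real (min_max_order n r s k)"
    by (intro min_max_order_lower_bound)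
  from a show "real (min_max_order n r s k)
      \<le> (real s + 1) * real_of_int \<lceil>real n / real_of_int \<lfloor>sqrt (2 * real r)\<rfloor>\<rceil>"
    by (intro min_max_order_upper_bound)
qed (rule min_max_order_ratio_tendsto_0 min_max_order_ratio_tendsto_1; assumption)+

end
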